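(* Consider a stable Phase 2 of the Extending Window Method (setting below). If there exist $k_0\in\mathbb{N}$, $k_0\ge2$, and $(x_1,\dots,x_{k_0+1})\in\mathcal{B}^{k_0+1}$ such that (i) $\#\mathcal{Q}_{[x_1,\dots,x_{k_0}]}>1$, and (ii) there is an infinite walk in the Rauzy graph $G_{k_0}$ starting in the vertex $(x_2,\dots,x_{k_0+1})$, then Phase 2 does not converge.
   Context: Setting: $\beta$ an algebraic integer, $\mathcal{A}\subset\mathbb{Z}[\beta]$ a finite alphabet, $\mathcal{B}\subset\mathbb{Z}[\beta]$ a finite input alphabet with $\mathcal{A}\subsetneq\mathcal{B}\subset\mathcal{A}+\mathcal{A}$, and $\mathcal{Q}\subset\mathbb{Z}[\beta]$ a finite set with $0\in\mathcal{Q}$ and $\mathcal{B}+\mathcal{Q}\subset\mathcal{A}+\beta\mathcal{Q}$. Phase 2 chooses, for each $n\ge1$ and $(x_1,\dots,x_n)\in\mathcal{B}^n$, a set $\mathcal{Q}_{[x_1,\dots,x_n]}\subset\mathcal{Q}$ with $x_1+\mathcal{Q}\subset\mathcal{A}+\beta\mathcal{Q}_{[x_1]}$, and for $n\ge2$, $\mathcal{Q}_{[x_1,\dots,x_n]}\subset\mathcal{Q}_{[x_1,\dots,x_{n-1}]}$ and $x_1+\mathcal{Q}_{[x_2,\dots,x_n]}\subset\mathcal{A}+\beta\mathcal{Q}_{[x_1,\dots,x_n]}$. Phase 2 converges if there is $n$ with $\#\mathcal{Q}_{[x_1,\dots,x_n]}=1$ for all $(x_1,\dots,x_n)\in\mathcal{B}^n$.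 Phase 2 is stable if for all $k\ge2$ and all $(x_1,\dots,x_{k+1})\in\mathcal{B}^{k+1}$: $\mathcal{Q}_{[x_2,\dots,x_{k+1}]}=\mathcal{Q}_{[x_2,\dots,x_k]}$ implies $\mathcal{Q}_{[x_1,\dots,x_{k+1}]}=\mathcal{Q}_{[x_1,\dots,x_k]}$. For $k\ge2$, the Rauzy graph $G_k=(V_k,E_k)$ is the directed graph with vertex set $V_k=\{(y_1,\dots,y_k)\in\mathcal{B}^k: \#\mathcal{Q}_{[y_1,\dots,y_k]}=\#\mathcal{Q}_{[y_1,\dots,y_{k-1}]}\}$ and an edge $(y_1,\dots,y_k)\to(y'_1,\dots,y'_k)$ between vertices whenever $(y_2,\dots,y_k)=(y'_1,\dots,y'_{k-1})$. *)

theory Defs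
  imports
    Complex_Main
    "HOL-Library.Set_Algebras"
    "HOL-Computational_Algebra.Polynomial"
    "Graph_Theory.Pair_Digraph"
begin

text \<open>The ring \<open>\<int>[\<beta>]\<close>.\<close>

definition int_adjoin :: "complex \<Rightarrow> complex set" where
  "int_adjoin \<beta> = {poly (map_poly of_int p) \<beta> | p :: int poly. True}"

text \<open>\<open>\<B>\<^sup>n\<close>; the tuple \<open>(x\<^sub>1, \<dots>, x\<^sub>n)\<close> is the list \<open>[x\<^sub>1, \<dots>, x\<^sub>n]\<close>.
  Thus \<^const>\<open>butlast\<close> drops the last letter and \<^const>\<open>tl\<close> the first one.\<close>

definition words :: "complex set \<Rightarrow> nat \<Rightarrow> complex list set" where
  "words B n = {w \<in> lists B. length w = n}"

locale extending_window =
  fixes \<beta> :: complex and A B Q :: "complex set"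
  assumes algebraic_int_beta: "algebraic_int \<beta>"
    and finite_A: "finite A" and A_subset: "A \<subseteq> int_adjoin \<beta>"
    and finite_B: "finite B" and B_subset: "B \<subseteq> int_adjoin \<beta>"
    and finite_Q: "finite Q" and Q_subset: "Q \<subseteq> int_adjoin \<beta>"
    and A_psubset_B: "A \<subset> B" and B_subset_sum: "B \<subseteq> A + A"
    and zero_in_Q: "0 \<in> Q"
    and B_plus_Q: "B + Q \<subseteq> A + \<beta> *o Q"

text \<open>\<open>Qw w\<close> is the set \<open>\<Q>\<^bsub>[w]\<^esub>\<close>. The value of \<open>Qw\<close> on the empty word, and on
  words that are not over \<open>B\<close>, is irrelevant.\<close>

locale phase2 = extending_window +
  fixes Qw :: "complex list \<Rightarrow> complex set"
  assumes Qw_subset: "\<And>n x. n \<ge> 1 \<Longrightarrow> x \<in> words B n \<Longrightarrow> Qw x \<subseteq> Q"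
    and Qw_first: "\<And>x. x \<in> B \<Longrightarrow> x +o Q \<subseteq> A + \<beta> *o Qw [x]"
    and Qw_mono: "\<And>n x. n \<ge> 2 \<Longrightarrow> x \<in> words B n \<Longrightarrow> Qw x \<subseteq> Qw (butlast x)"
    and Qw_step: "\<And>n x. n \<ge> 2 \<Longrightarrow> x \<in> words B n \<Longrightarrow> hd x +o Qw (tl x) \<subseteq> A + \<beta> *o Qw x"

definition phase2_converges :: "complex set \<Rightarrow> (complex list \<Rightarrow> complex set) \<Rightarrow> bool" where
  "phase2_converges B Qw \<longleftrightarrow> (\<exists>n\<ge>1. \<forall>x\<in>words B n. card (Qw x) = 1)"

definition phase2_stable :: "complex set \<Rightarrow> (complex list \<Rightarrow> complex set) \<Rightarrow> bool" where
  "phase2_stable B Qw \<longleftrightarrow>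
     (\<forall>k\<ge>2. \<forall>x\<in>words B (k + 1).
        Qw (tl x) = Qw (butlast (tl x)) \<longrightarrow> Qw x = Qw (butlast x))"

definition rauzy_verts ::
  "complex set \<Rightarrow> (complex list \<Rightarrow> complex set) \<Rightarrow> nat \<Rightarrow> complex list set" where
  "rauzy_verts B Qw k = {y \<in> words B k. card (Qw y) = card (Qw (butlast y))}"

definition rauzy_graph ::
  "complex set \<Rightarrow> (complex list \<Rightarrow> complex set) \<Rightarrow> nat \<Rightarrow> complex list pair_pre_digraph" where
  "rauzy_graph B Qw k =
     \<lparr> pverts = rauzy_verts B Qw k,
       parcs = {(y, y'). y \<in> rauzy_verts B Qw k \<and> y' \<in> rauzy_verts B Qw k \<and> tl y = butlast y'} \<rparr>"

definition infinite_walk_from :: "'a pair_pre_digraph \<Rightarrow> 'a \<Rightarrow> (nat \<Rightarrow> 'a) \<Rightarrow> bool" where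
  "infinite_walk_from G v w \<longleftrightarrow>
     v \<in> pverts G \<and> w 0 = v \<and> (\<forall>i. (w i, w (Suc i)) \<in> parcs G)"

end

theory Submission
  imports Defs
begin

text \<open>The walk spells out an infinite word \<open>s\<close> whose windows of length \<open>k\<^sub>0\<close> from position \<open>1\<close> on
  are the visited vertices. At a vertex the last letter does not shrink \<open>\<Q>\<close>; stability lets one
  prepend the preceding letters of \<open>s\<close> one at a time while preserving this, until the prefix of \<open>s\<close>
  is reached. Hence all prefixes of \<open>s\<close> of length at least \<open>k\<^sub>0\<close> have the same, non-singleton,
  set.\<close>

lemma map_upt_in_words:
  assumes "range s \<subseteq> B"
  shows "map s [i..<j] \<in> words B (j - i)"
  using assms by (fastforce simp: words_def)

lemma butlast_map_upt_Suc: "i \<le> n \<Longrightarrow> butlast (map s [i..<Suc n]) = map s [i..<n]"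
  by simp

lemma tl_map_upt: "tl (map s [i..<n]) = map s [Suc i..<n]"
  by (simp flip: map_tl)

text \<open>Stability, applied to the word \<open>s i, ..., s n\<close>, moves the start of the
  window from \<open>Suc i\<close> back to \<open>i\<close>; induction on the start repeats this
  down to \<open>0\<close>. The bound \<open>i < n\<close> keeps the shorter window
  nonempty.\<close>

lemma stable_prefix:
  assumes "phase2_stable B Qw" and "range s \<subseteq> B" and "i < n"
    and "Qw (map s [i..<Suc n]) = Qw (map s [i..<n])"
  shows "Qw (map s [0..<Suc n]) = Qw (map s [0..<n])"
  using assms(3,4)
proof (induction i)
  case 0
  then show ?case by blast
next
  case (Suc i)
  let ?x = "map s [i..<Suc n]"
  have x: "?x \<in> words B ((n - i) + 1)"
    using map_upt_in_words[OF assms(2), of i "Suc n"] Suc.prems(1) by (simp add: Suc_diff_le)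
  have tl: "tl ?x = map s [Suc i..<Suc n]" by (rule tl_map_upt)
  have bl: "butlast (tl ?x) = map s [Suc i..<n]"
    unfolding tl using Suc.prems(1) by (intro butlast_map_upt_Suc) simp
  have "Qw (tl ?x) = Qw (butlast (tl ?x))"
    unfolding bl unfolding tl by (rule Suc.prems(2))
  \<comment> \<open>Stability is used with its \<open>k\<close> equal to \<open>n - i\<close>; the
    side condition \<open>k \<ge> 2\<close> is supplied by \<open>Suc i < n\<close>.\<close>
  moreover have "2 \<le> n - i" using Suc.prems(1) by simp
  ultimately have "Qw ?x = Qw (butlast ?x)"
    using assms(1) x unfolding phase2_stable_def by blast
  also have "butlast ?x = map s [i..<n]"
    using Suc.prems(1) by (intro butlast_map_upt_Suc) simp
  finally show ?case using Suc.IH Suc.prems(1) by simp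
qed

text \<open>Vertices compare only cardinalities, while stability speaks of equal sets. The inclusion
  \<open>Qw_mono\<close> between finite sets bridges the gap.\<close>

lemma (in phase2) Qw_eq_if_rauzy_vert:
  assumes "k \<ge> 2" and "y \<in> rauzy_verts B Qw k"
  shows "Qw y = Qw (butlast y)"
proof (rule card_subset_eq)
  have y: "y \<in> words B k" and c: "card (Qw y) = card (Qw (butlast y))"
    using assms(2) by (auto simp: rauzy_verts_def)
  then have "butlast y \<in> words B (k - 1)"
    by (auto simp: words_def dest: in_set_butlastD)
  then show "finite (Qw (butlast y))"
    using Qw_subset[of "k - 1" "butlast y"] finite_Q assms(1) finite_subset by fastforce
  show "Qw y \<subseteq> Qw (butlast y)" by (rule Qw_mono[OF assms(1) y])
  show "card (Qw y) = card (Qw (butlast y))" by (rule c)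
qed

lemma (in phase2) Qw_prefix_antimono:
  assumes "range s \<subseteq> B" and "1 \<le> m" and "m \<le> n"
  shows "Qw (map s [0..<n]) \<subseteq> Qw (map s [0..<m])"
  using assms(3)
proof (induction n rule: dec_induct)
  case base
  show ?case ..
next
  case (step n)
  have "map s [0..<Suc n] \<in> words B (Suc n)"
    using map_upt_in_words[OF assms(1), of 0 "Suc n"] by simp
  then have "Qw (map s [0..<Suc n]) \<subseteq> Qw (butlast (map s [0..<Suc n]))"
    using Qw_mono[of "Suc n"] step assms(2) by fastforce
  then show ?case using step by simp
qed

text \<open>Each edge shifts the letters one place to the left, so letter \<open>j\<close> of
  \<open>w i\<close> becomes the first letter of \<open>w (i + j)\<close> after \<open>j\<close>
  edges. The first letters thus determine the whole walk.\<close>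

lemma walk_eq_windows:
  assumes len: "\<And>i. length (w i) = k" and step: "\<And>i. tl (w i) = butlast (w (Suc i))"
  shows "w i = map (\<lambda>n. hd (w n)) [i..<i + k]"
proof -
  have nth: "w i ! j = hd (w (i + j))" if "j < k" for i j
    using that
  proof (induction j arbitrary: i)
    case 0
    then have "w i \<noteq> []" using len[of i] by auto
    then show ?case by (simp add: hd_conv_nth)
  next
    case (Suc j)
    have "w i ! Suc j = tl (w i) ! j" using Suc.prems len[of i] by (simp add: nth_tl)
    also have "\<dots> = w (Suc i) ! j"
      using Suc.prems len[of "Suc i"] by (simp add: step nth_butlast)
    also have "\<dots> = hd (w (i + Suc j))" using Suc by simp
    finally show ?case .
  qed
  show ?thesis by (rule nth_equalityI) (simp_all add: len nth)
qed

theorem theorem21: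
  fixes \<beta> :: complex and A B Q :: "complex set" and Qw :: "complex list \<Rightarrow> complex set"
  assumes "phase2 \<beta> A B Q Qw"
    and "phase2_stable B Qw"
    and "\<exists>k\<^sub>0\<ge>2. \<exists>x\<in>words B (k\<^sub>0 + 1).
           card (Qw (butlast x)) > 1 \<and>
           (\<exists>w. infinite_walk_from (rauzy_graph B Qw k\<^sub>0) (tl x) w)"
  shows "\<not> phase2_converges B Qw"
proof
  interpret phase2 \<beta> A B Q Qw by fact
  obtain k x w where k: "k \<ge> 2" and x: "x \<in> words B (k + 1)"
    and card: "card (Qw (butlast x)) > 1"
    and walk: "infinite_walk_from (rauzy_graph B Qw k) (tl x) w"
    using assms(3) by blast
  have w0: "w 0 = tl x" and verts: "\<And>i. w i \<in> rauzy_verts B Qw k"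
    and step: "\<And>i. tl (w i) = butlast (w (Suc i))"
    using walk by (auto simp: infinite_walk_from_def rauzy_graph_def)
  have words: "w i \<in> words B k" for i
    using verts by (simp add: rauzy_verts_def)
  then have len: "length (w i) = k" for i by (simp add: words_def)
  \<comment> \<open>The letter \<open>hd x\<close> is put in front of the word spelled by the walk.
    Hence \<open>w i\<close> sits at positions \<open>Suc i\<close> to \<open>i + k\<close>, and
    \<open>x\<close> is the prefix of length \<open>k + 1\<close>.\<close>
  define s where "s n = (case n of 0 \<Rightarrow> hd x | Suc i \<Rightarrow> hd (w i))" for n
  have "x \<noteq> []" using x by (auto simp: words_def)
  have "hd (w i) \<in> B" for i
    using words[of i] k by (cases "w i") (auto simp: words_def)
  moreover have "hd x \<in> B" using x \<open>x \<noteq> []\<close> by (cases x) (auto simp: words_def)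
  ultimately have sB: "range s \<subseteq> B" by (auto simp: s_def split: nat.split)
  have window: "w i = map s [Suc i..<Suc (i + k)]" for i
  proof -
    have "w i = map (s \<circ> Suc) [i..<i + k]"
      unfolding walk_eq_windows[of w, OF len step, of i] by (simp add: s_def)
    then show ?thesis by (simp only: map_map[symmetric] map_Suc_upt)
  qed
  have "x = hd x # w 0" using \<open>x \<noteq> []\<close> w0 by simp
  also have "\<dots> = map s [0..<Suc k]"
    unfolding window[of 0] by (simp add: s_def upt_conv_Cons del: upt_Suc)
  finally have "butlast x = map s [0..<k]" by simp
  then have card_k: "card (Qw (map s [0..<k])) > 1" using card by simp
  \<comment> \<open>The window starting at \<open>Suc i\<close> is the vertex \<open>w i\<close>,
    whose last letter \<open>s (i + k)\<close> leaves the set unchanged; this carries over to the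
    prefix.\<close>
  have "Qw (map s [0..<Suc (i + k)]) = Qw (map s [0..<i + k])" for i
  proof (rule stable_prefix[OF assms(2) sB])
    show "Suc i < i + k" using k by simp
    then have "butlast (w i) = map s [Suc i..<i + k]"
      unfolding window[of i] by (intro butlast_map_upt_Suc) simp
    then show "Qw (map s [Suc i..<Suc (i + k)]) = Qw (map s [Suc i..<i + k])"
      using Qw_eq_if_rauzy_vert[OF k verts[of i]] window[of i] by simp
  qed
  then have const: "Qw (map s [0..<i + k]) = Qw (map s [0..<k])" for i
    by (induction i) (simp_all del: upt_Suc)
  assume "phase2_converges B Qw"
  then obtain n where n: "n \<ge> 1" and conv: "\<And>y. y \<in> words B n \<Longrightarrow> card (Qw y) = 1"
    unfolding phase2_converges_def by blast
  have word_n: "map s [0..<n] \<in> words B n" using map_upt_in_words[OF sB, of 0 n] by simp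
  \<comment> \<open>The length \<open>n\<close> may be smaller than \<open>k\<close>. The prefix of
    length \<open>n + k\<close> is long enough for \<open>const\<close> and also extends the one of
    length \<open>n\<close>.\<close>
  have "Qw (map s [0..<n + k]) \<subseteq> Qw (map s [0..<n])"
    using n by (intro Qw_prefix_antimono[OF sB]) simp_all
  moreover have "finite (Qw (map s [0..<n]))"
    using Qw_subset[OF n word_n] finite_Q by (rule finite_subset)
  ultimately have "card (Qw (map s [0..<k])) \<le> card (Qw (map s [0..<n]))"
    unfolding const by (intro card_mono)
  then show False using card_k conv[OF word_n] by simp
qed

end
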